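(* Let $\Gamma$ be a metric graph with vertex weights $h$ and let $D=K+\mathrm{div}(f)$ be an effective divisor in $|K|$. Let $v$ be a vertex and denote by $s_1,\dots,s_r$ the outgoing slopes of $f$ along the edges of $\Gamma$ adjacent to $v$. Then $v$ is inconvenient if and only if $h(v)=0$, $s_j\ne0$ for all $j$, and there is an $i$ such that $s_i<0$ and $$-s_i>\sum_{j:\,s_j>0}s_j.$$
   Context: Metric graph: the geometric realization of a finite graph with positive edge lengths; $\mathrm{val}(x)$ is the number of half-edges at $x$; a model has a finite vertex set $V$ whose complement is a disjoint union of open intervals (edges). The vertices carry weights $h:V\to\mathbb N$ (and $h=0$ at points not in the original vertex set). The canonical divisor is $K=\sum_{x\in V}(2h(x)-2+\mathrm{val}(x))\,x$. A rational function is a continuous piecewise linear $f:\Gamma\to\mathbb R$ with integer slopes; $s_\zeta(f)$ is the slope of $f$ along the tangent direction (half-edge) $\zeta$ at a point; $\mathrm{div}(f)=\sum_x\big(\sum_{\zeta\text{ at }x}s_\zeta(f)\big)\,x$. A divisor $D$ is effective if $D(x)\ge0$ for all $x$; $|K|$ is the set of effective divisors of the form $K+\mathrm{div}(f)$. Enhanced level graph $\Gamma^+(f)$ associated with $D=K+\mathrm{div}(f)\in|K|$: subdivide the model so that $D$ is supported on vertices (and $f$ is linear on edges). For each vertex $x$ attach $D(x)$ legs (infinite half-rays) at $x$, and extend $f$ linearly to each leg with outgoing slope $-2$. The vertices are ordered (by level) according to the values of $f$. For each tangent direction $\zeta$ at a vertex (along an edge or a leg) put $k(\zeta)=-s_\zeta(f)-1$.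 The type $\mu(v)=(k_1,\dots,k_n)$ of a vertex $v$ is the tuple, in decreasing order, of the $k(\zeta)$ for all $n$ tangent directions $\zeta$ at $v$ in $\Gamma^+(f)$ (edges and legs). A vertex $v$ is inconvenient if $h(v)=0$ and its type $\mu(v)=(k_1,\dots,k_n)$ satisfies: (i) $k_i\ne-1$ for all $i$; (ii) there is an index $i$ such that $k_i>\big(\sum_{k_j<0}-k_j\big)-\#\{j:k_j<0\}-1$. *)

theory Defs
  imports Complex_Main "HOL-Library.Multiset"
begin

text \<open>
  A finite vertex-weighted graph with edge lengths; loops, multiple edges and isolated vertices
  are allowed. The orientation given by \<open>src\<close> and \<open>tgt\<close> only serves to parametrise the edges.
\<close>

record ('v, 'e) mgraph =
  verts :: "'v set"
  edges :: "'e set"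
  src :: "'e \<Rightarrow> 'v"
  tgt :: "'e \<Rightarrow> 'v"
  len :: "'e \<Rightarrow> real"
  weight :: "'v \<Rightarrow> nat"

definition metric_graph :: "('v, 'e) mgraph \<Rightarrow> bool" where
  "metric_graph G \<longleftrightarrow> finite (verts G) \<and> finite (edges G) \<and>
     (\<forall>e\<in>edges G. src G e \<in> verts G \<and> tgt G e \<in> verts G \<and> 0 < len G e)"

text \<open>
  The geometric realization: \<open>Inn e t\<close> is the point in the interior of the edge \<open>e\<close> at distance
  \<open>t\<close> from its source, and \<open>chart G e\<close> is the characteristic map from \<open>[0, len e]\<close>, which glues the
  end points of the interval to the vertices.
\<close>

datatype ('v, 'e) point = Vtx 'v | Inn 'e real

definition points :: "('v, 'e) mgraph \<Rightarrow> ('v, 'e) point set" where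
  "points G = Vtx ` verts G \<union> {Inn e t | e t. e \<in> edges G \<and> 0 < t \<and> t < len G e}"

definition chart :: "('v, 'e) mgraph \<Rightarrow> 'e \<Rightarrow> real \<Rightarrow> ('v, 'e) point" where
  "chart G e t =
     (if t = 0 then Vtx (src G e) else if t = len G e then Vtx (tgt G e) else Inn e t)"

fun point_weight :: "('v, 'e) mgraph \<Rightarrow> ('v, 'e) point \<Rightarrow> nat" where
  "point_weight G (Vtx x) = (if x \<in> verts G then weight G x else 0)"
| "point_weight G (Inn e t) = 0"

text \<open>
  \<open>Dir e t True\<close> and \<open>Dir e t False\<close> are the tangent directions (half-edges) at the point
  \<open>chart G e t\<close> pointing along \<open>e\<close> towards its target and its source, respectively. A loop
  contributes two directions at its vertex, \<open>Dir e 0 True\<close> and \<open>Dir e (len e) False\<close>.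
\<close>

datatype 'e dir = Dir 'e real bool

definition tangents :: "('v, 'e) mgraph \<Rightarrow> ('v, 'e) point \<Rightarrow> 'e dir set" where
  "tangents G p =
     {Dir e t True | e t. e \<in> edges G \<and> 0 \<le> t \<and> t < len G e \<and> chart G e t = p} \<union>
     {Dir e t False | e t. e \<in> edges G \<and> 0 < t \<and> t \<le> len G e \<and> chart G e t = p}"

definition val :: "('v, 'e) mgraph \<Rightarrow> ('v, 'e) point \<Rightarrow> nat" where
  "val G p = card (tangents G p)"

fun walk :: "('v, 'e) mgraph \<Rightarrow> 'e dir \<Rightarrow> real \<Rightarrow> ('v, 'e) point" where
  "walk G (Dir e t fwd) \<epsilon> = chart G e (if fwd then t + \<epsilon> else t - \<epsilon>)"

text \<open>
  A real function on the realization is continuous iff its composition with every \<open>chart\<close> is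
  continuous, since the realization carries the quotient topology.
\<close>

definition rational_function :: "('v, 'e) mgraph \<Rightarrow> (('v, 'e) point \<Rightarrow> real) \<Rightarrow> bool" where
  "rational_function G f \<longleftrightarrow>
     (\<forall>e\<in>edges G.
        continuous_on {0..len G e} (\<lambda>t. f (chart G e t)) \<and>
        (\<exists>B. finite B \<and>
           (\<forall>a b. 0 \<le> a \<and> a < b \<and> b \<le> len G e \<and> {a<..<b} \<inter> B = {} \<longrightarrow>
              (\<exists>(m::int) c. \<forall>t\<in>{a<..<b}. f (chart G e t) = of_int m * t + c))))"

text \<open>The slope at \<open>0\<close> of a function that is linear with integer slope on some \<open>[0, \<delta>)\<close>.\<close>

definition germ_slope :: "(real \<Rightarrow> real) \<Rightarrow> int" where
  "germ_slope g = (THE m. \<forall>\<^sub>F \<epsilon> in at_right 0. g \<epsilon> = g 0 + of_int m * \<epsilon>)"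

definition slope :: "('v, 'e) mgraph \<Rightarrow> (('v, 'e) point \<Rightarrow> real) \<Rightarrow> 'e dir \<Rightarrow> int" where
  "slope G f \<zeta> = germ_slope (\<lambda>\<epsilon>. f (walk G \<zeta> \<epsilon>))"

text \<open>
  Divisors are integer-valued functions on points, with the convention that they vanish on
  elements of the type \<open>point\<close> that do not belong to \<open>points G\<close>.
\<close>

type_synonym ('v, 'e) divisor = "('v, 'e) point \<Rightarrow> int"

definition div_of :: "('v, 'e) mgraph \<Rightarrow> (('v, 'e) point \<Rightarrow> real) \<Rightarrow> ('v, 'e) divisor" where
  "div_of G f p = (\<Sum>\<zeta>\<in>tangents G p. slope G f \<zeta>)"

definition canonical_divisor :: "('v, 'e) mgraph \<Rightarrow> ('v, 'e) divisor" where
  "canonical_divisor G p =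
     (if p \<in> Vtx ` verts G then 2 * int (point_weight G p) - 2 + int (val G p) else 0)"

definition effective :: "('v, 'e) mgraph \<Rightarrow> ('v, 'e) divisor \<Rightarrow> bool" where
  "effective G D \<longleftrightarrow> (\<forall>p\<in>points G. 0 \<le> D p)"

definition K_plus_div :: "('v, 'e) mgraph \<Rightarrow> (('v, 'e) point \<Rightarrow> real) \<Rightarrow> ('v, 'e) divisor" where
  "K_plus_div G f = (\<lambda>p. canonical_divisor G p + div_of G f p)"

definition canonical_system :: "('v, 'e) mgraph \<Rightarrow> ('v, 'e) divisor set" where
  "canonical_system G = {D. effective G D \<and> (\<exists>f. rational_function G f \<and> D = K_plus_div G f)}"

text \<open>
  A subdivision of the given model is determined by its finite vertex set \<open>W\<close>, a set of points
  containing the original vertices; its open edges are the components of the complement of \<open>W\<close>.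
\<close>

definition adapted_subdivision ::
  "('v, 'e) mgraph \<Rightarrow> (('v, 'e) point \<Rightarrow> real) \<Rightarrow> ('v, 'e) point set \<Rightarrow> bool" where
  "adapted_subdivision G f W \<longleftrightarrow>
     finite W \<and> W \<subseteq> points G \<and> Vtx ` verts G \<subseteq> W \<and>
     (\<forall>p\<in>points G. K_plus_div G f p \<noteq> 0 \<longrightarrow> p \<in> W) \<and>
     (\<forall>e\<in>edges G. \<forall>a b. 0 \<le> a \<and> a < b \<and> b \<le> len G e \<and> chart G e ` {a<..<b} \<inter> W = {} \<longrightarrow>
        (\<exists>m c. \<forall>t\<in>{a<..<b}. f (chart G e t) = m * t + c))"

text \<open>
  The enhanced level graph. Its underlying space is the realization with a half-ray glued at \<open>x\<close>
  for every leg \<open>(x, i)\<close>; \<open>LegPt x i t\<close>, \<open>t > 0\<close>, is the point of that ray at distance \<open>t\<close> from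
  \<open>x\<close>. Subdividing changes neither the realization nor its tangent directions, so the
  tangent directions at a vertex are those of \<open>G\<close> together with the legs.
\<close>

datatype ('v, 'e) lpoint = Base "('v, 'e) point" | LegPt "('v, 'e) point" nat real

datatype ('v, 'e) ldir = EdgeDir "'e dir" | LegDir "('v, 'e) point" nat

record ('v, 'e) level_graph =
  base :: "('v, 'e) mgraph"
  lverts :: "('v, 'e) point set"
  legs :: "(('v, 'e) point \<times> nat) set"
  lfun :: "('v, 'e) lpoint \<Rightarrow> real"
  level_order :: "(('v, 'e) point \<times> ('v, 'e) point) set"

fun extend_to_legs :: "(('v, 'e) point \<Rightarrow> real) \<Rightarrow> ('v, 'e) lpoint \<Rightarrow> real" where
  "extend_to_legs f (Base p) = f p"
| "extend_to_legs f (LegPt x i t) = f x - 2 * t"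

definition enhanced_level_graph ::
  "('v, 'e) mgraph \<Rightarrow> (('v, 'e) point \<Rightarrow> real) \<Rightarrow> ('v, 'e) point set \<Rightarrow> ('v, 'e) level_graph" where
  "enhanced_level_graph G f W =
     \<lparr>base = G,
      lverts = W,
      legs = {(x, i). x \<in> W \<and> i < nat (K_plus_div G f x)},
      lfun = extend_to_legs f,
      level_order = {(x, y). x \<in> W \<and> y \<in> W \<and> f x \<le> f y}\<rparr>"

definition ltangents :: "('v, 'e) level_graph \<Rightarrow> ('v, 'e) point \<Rightarrow> ('v, 'e) ldir set" where
  "ltangents L x = EdgeDir ` tangents (base L) x \<union> {LegDir x i | i. (x, i) \<in> legs L}"

fun lwalk :: "('v, 'e) level_graph \<Rightarrow> ('v, 'e) ldir \<Rightarrow> real \<Rightarrow> ('v, 'e) lpoint" where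
  "lwalk L (EdgeDir \<zeta>) \<epsilon> = Base (walk (base L) \<zeta> \<epsilon>)"
| "lwalk L (LegDir x i) \<epsilon> = (if \<epsilon> = 0 then Base x else LegPt x i \<epsilon>)"

definition lslope :: "('v, 'e) level_graph \<Rightarrow> ('v, 'e) ldir \<Rightarrow> int" where
  "lslope L \<zeta> = germ_slope (\<lambda>\<epsilon>. lfun L (lwalk L \<zeta> \<epsilon>))"

definition enhancement :: "('v, 'e) level_graph \<Rightarrow> ('v, 'e) ldir \<Rightarrow> int" where
  "enhancement L \<zeta> = - lslope L \<zeta> - 1"

definition vertex_type :: "('v, 'e) level_graph \<Rightarrow> ('v, 'e) point \<Rightarrow> int list" where
  "vertex_type L v =
     rev (sorted_list_of_multiset (image_mset (enhancement L) (mset_set (ltangents L v))))"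

definition inconvenient :: "('v, 'e) level_graph \<Rightarrow> ('v, 'e) point \<Rightarrow> bool" where
  "inconvenient L v \<longleftrightarrow>
     v \<in> lverts L \<and> point_weight (base L) v = 0 \<and>
     (let k = vertex_type L v; n = length k; N = {j. j < n \<and> k ! j < 0} in
        (\<forall>i<n. k ! i \<noteq> -1) \<and>
        (\<exists>i<n. k ! i > (\<Sum>j\<in>N. - (k ! j)) - int (card N) - 1))"

end

theory Submission
  imports Defs
begin

text \<open>
  Legs have \<open>k = 1\<close> and edges have \<open>k = - s - 1\<close>, so \<open>k < 0\<close> singles out the edges with
  \<open>s \<ge> 0\<close> and the bound in (ii) equals \<open>S - 1\<close>, where \<open>S\<close> is the sum of the positive slopes.
  For an edge, (ii) therefore reads \<open>- s > S\<close>. A leg satisfies (ii) only if \<open>S \<le> 1\<close>; then at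
  most one slope is positive, and if no slope vanishes,
  \<open>D(v) = - 2 + (\<Sum>j. s\<^sub>j + 1) \<le> - 2 + 2 = 0\<close>, so that there are no legs at \<open>v\<close>.
\<close>

lemma germ_slope_eqI:
  assumes "\<forall>\<^sub>F \<epsilon> in at_right 0. g \<epsilon> = g 0 + of_int m * \<epsilon>"
  shows "germ_slope g = m"
  unfolding germ_slope_def
proof (rule the_equality)
  show "\<forall>\<^sub>F \<epsilon> in at_right 0. g \<epsilon> = g 0 + of_int m * \<epsilon>"
    by (rule assms)
next
  fix m' :: int
  assume "\<forall>\<^sub>F \<epsilon> in at_right 0. g \<epsilon> = g 0 + of_int m' * \<epsilon>"
  \<comment> \<open>Both expansions hold at every small positive \<open>\<epsilon>\<close>;
    cancelling \<open>\<epsilon>\<close> leaves the constant statement \<open>m' = m\<close>, and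
    \<open>at_right 0\<close> is a nontrivial filter.\<close>
  with assms have "\<forall>\<^sub>F \<epsilon> in at_right (0::real). m' = m"
    using eventually_at_right_less[of "0::real"] by eventually_elim auto
  then show "m' = m"
    by simp
qed

lemma tangents_Vtx:
  "tangents G (Vtx x) \<subseteq>
    (\<lambda>e. Dir e 0 True) ` edges G \<union> (\<lambda>e. Dir e (len G e) False) ` edges G"
  by (auto simp: tangents_def chart_def split: if_splits)

lemma tangents_Inn:
  assumes "e \<in> edges G" "0 < t" "t < len G e"
  shows "tangents G (Inn e t) = {Dir e t True, Dir e t False}"
proof -
  have "chart G e' t' = Inn e t \<longleftrightarrow> e' = e \<and> t' = t" for e' t'
    using assms by (auto simp: chart_def)
  then show ?thesis
    using assms by (auto simp: tangents_def)
qed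

lemma points_cases:
  assumes "p \<in> points G"
  obtains (Vtx) x where "x \<in> verts G" "p = Vtx x"
  | (Inn) e t where "e \<in> edges G" "0 < t" "t < len G e" "p = Inn e t"
  using assms unfolding points_def by blast

lemma finite_tangents:
  assumes "metric_graph G" "p \<in> points G"
  shows "finite (tangents G p)"
  using assms(2)
proof (cases rule: points_cases)
  case (Vtx x)
  have "finite (edges G)"
    using assms(1) by (simp add: metric_graph_def)
  then show ?thesis
    using finite_subset[OF tangents_Vtx[of G x]] Vtx by blast
qed (simp add: tangents_Inn)

text \<open>An interior point of an edge has weight 0 and valence 2, so \<open>2 h - 2 + val\<close>
  vanishes there. The vertex formula thus also covers the vertices added by subdivision.\<close>

lemma K_plus_div_eq:
  assumes "p \<in> points G"
  shows "K_plus_div G f p =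
    2 * int (point_weight G p) - 2 + int (val G p) + (\<Sum>\<zeta>\<in>tangents G p. slope G f \<zeta>)"
  using assms
proof (cases rule: points_cases)
  case (Inn e t)
  then show ?thesis
    by (auto simp: K_plus_div_def canonical_divisor_def div_of_def val_def tangents_Inn)
qed (auto simp: K_plus_div_def canonical_divisor_def div_of_def)

lemma enhancement_EdgeDir:
  "enhancement (enhanced_level_graph G f W) (EdgeDir \<zeta>) = - slope G f \<zeta> - 1"
  by (simp add: enhancement_def lslope_def slope_def enhanced_level_graph_def)

lemma enhancement_LegDir: "enhancement (enhanced_level_graph G f W) (LegDir x i) = 1"
proof -
  have "lslope (enhanced_level_graph G f W) (LegDir x i) = - 2"
    unfolding lslope_def
    by (rule germ_slope_eqI, rule eventually_mono[OF eventually_at_right_less])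
      (auto simp: enhanced_level_graph_def)
  then show ?thesis
    by (simp add: enhancement_def)
qed

lemma ltangents_enhanced_level_graph:
  assumes "x \<in> W"
  shows "ltangents (enhanced_level_graph G f W) x =
    EdgeDir ` tangents G x \<union> LegDir x ` {..<nat (K_plus_div G f x)}"
  using assms by (auto simp: ltangents_def enhanced_level_graph_def)

lemma mset_vertex_type:
  "mset (vertex_type L v) = image_mset (enhancement L) (mset_set (ltangents L v))"
  by (simp add: vertex_type_def)

text \<open>Turns sums over list positions into sums over the multiset of entries, where the
  decreasing order of the type is irrelevant and repeated values keep their multiplicity.\<close>

lemma sum_nth_filter:
  fixes g :: "'a \<Rightarrow> 'b::comm_monoid_add"
  shows "(\<Sum>j | j < length xs \<and> P (xs ! j). g (xs ! j)) = (\<Sum>x\<in>#filter_mset P (mset xs). g x)"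
proof -
  have "(\<Sum>j | j < length xs \<and> P (xs ! j). g (xs ! j)) =
      (\<Sum>j<length xs. if P (xs ! j) then g (xs ! j) else 0)"
    by (simp add: sum.If_cases lessThan_def Collect_conj_eq)
  also have "\<dots> = (\<Sum>x\<leftarrow>xs. if P x then g x else 0)"
    by (simp add: sum_list_sum_nth atLeast0LessThan)
  also have "\<dots> = (\<Sum>x\<leftarrow>filter P xs. g x)"
    by (simp add: sum_list_map_filter')
  also have "\<dots> = (\<Sum>x\<in>#filter_mset P (mset xs). g x)"
    by (metis mset_filter mset_map sum_mset_sum_list)
  finally show ?thesis .
qed

text \<open>Conditions (i) and (ii) do not depend on the order of the type, so positions can be
  replaced by tangent directions. The cardinality in (ii) is absorbed as one \<open>- 1\<close> in
  each summand.\<close>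

lemma inconvenient_iff:
  assumes "finite (ltangents L v)"
  shows "inconvenient L v \<longleftrightarrow> v \<in> lverts L \<and> point_weight (base L) v = 0 \<and>
    (\<forall>\<zeta>\<in>ltangents L v. enhancement L \<zeta> \<noteq> -1) \<and>
    (\<exists>\<zeta>\<in>ltangents L v. enhancement L \<zeta> >
       (\<Sum>\<eta> | \<eta> \<in> ltangents L v \<and> enhancement L \<eta> < 0. - enhancement L \<eta> - 1) - 1)"
proof -
  define k where "k = vertex_type L v"
  \<comment> \<open>Finiteness matters here: \<open>mset_set\<close> of an infinite set is
    empty.\<close>
  have set_k: "set k = enhancement L ` ltangents L v"
    using arg_cong[OF mset_vertex_type, of set_mset L v] assms by (simp add: k_def)
  have "(\<Sum>j | j < length k \<and> k ! j < 0. - (k ! j)) - int (card {j. j < length k \<and> k ! j < 0}) =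
      (\<Sum>j | j < length k \<and> k ! j < 0. - (k ! j) - 1)"
    by (simp add: sum_subtractf)
  also have "\<dots> = (\<Sum>x\<in>#filter_mset (\<lambda>x. x < 0) (mset k). - x - 1)"
    by (rule sum_nth_filter)
  also have "\<dots> = (\<Sum>\<eta> | \<eta> \<in> ltangents L v \<and> enhancement L \<eta> < 0. - enhancement L \<eta> - 1)"
    using assms
    by (simp add: k_def mset_vertex_type filter_mset_image_mset filter_mset_mset_set
        image_mset.compositionality comp_def sum_unfold_sum_mset)
  finally have bound: "(\<Sum>j | j < length k \<and> k ! j < 0. - (k ! j)) -
      int (card {j. j < length k \<and> k ! j < 0}) =
      (\<Sum>\<eta> | \<eta> \<in> ltangents L v \<and> enhancement L \<eta> < 0. - enhancement L \<eta> - 1)" .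
  have all: "(\<forall>i<length k. Q (k ! i)) \<longleftrightarrow> (\<forall>\<zeta>\<in>ltangents L v. Q (enhancement L \<zeta>))"
    and ex: "(\<exists>i<length k. Q (k ! i)) \<longleftrightarrow> (\<exists>\<zeta>\<in>ltangents L v. Q (enhancement L \<zeta>))" for Q
    using set_k by (simp_all flip: all_set_conv_all_nth add: Bex_def,
        metis (no_types, lifting) image_iff in_set_conv_nth)
  show ?thesis
    using all[of "\<lambda>x. x \<noteq> - 1"] ex[of "\<lambda>x. x > b - 1" for b]
    unfolding inconvenient_def Let_def k_def[symmetric] bound by simp
qed

text \<open>By integrality, a negative \<open>s a\<close> gives \<open>s a + 1 \<le> 0\<close>,
  while a positive one gives \<open>s a + 1 \<le> 2 * s a\<close>. Hence the sum is at most twice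
  the sum of the positive values.\<close>

lemma sum_plus_one_le_two:
  fixes s :: "'a \<Rightarrow> int"
  assumes "finite A" "\<forall>a\<in>A. s a \<noteq> 0" "(\<Sum>a | a \<in> A \<and> s a > 0. s a) \<le> 1"
  shows "(\<Sum>a\<in>A. s a + 1) \<le> 2"
proof -
  let ?P = "{a \<in> A. s a > 0}"
  have "(\<Sum>a\<in>A. s a + 1) \<le> (\<Sum>a\<in>A. if s a > 0 then s a + 1 else 0)"
    using assms(2) by (intro sum_mono) force
  also have "\<dots> = (\<Sum>a\<in>?P. s a + 1)"
    using assms(1) by (simp add: sum.inter_filter)
  also have "\<dots> \<le> (\<Sum>a\<in>?P. 2 * s a)"
    by (intro sum_mono) auto
  also have "\<dots> \<le> 2"
    using assms(3) by (simp flip: sum_distrib_left)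
  finally show ?thesis .
qed

theorem proposition3p20:
  fixes G :: "('v, 'e) mgraph"
    and f :: "('v, 'e) point \<Rightarrow> real"
    and D :: "('v, 'e) divisor"
    and W :: "('v, 'e) point set"
    and v :: "('v, 'e) point"
  assumes "metric_graph G"
    and "rational_function G f"
    and "D = K_plus_div G f"
    and "D \<in> canonical_system G"
    and "adapted_subdivision G f W"
    and "v \<in> W"
  shows "inconvenient (enhanced_level_graph G f W) v \<longleftrightarrow>
    point_weight G v = 0 \<and>
    (\<forall>\<zeta>\<in>tangents G v. slope G f \<zeta> \<noteq> 0) \<and>
    (\<exists>\<zeta>\<in>tangents G v. slope G f \<zeta> < 0 \<and>
       - slope G f \<zeta> > (\<Sum>\<eta> | \<eta> \<in> tangents G v \<and> slope G f \<eta> > 0. slope G f \<eta>))"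
proof -
  let ?L = "enhanced_level_graph G f W"
  define S where "S = (\<Sum>\<eta> | \<eta> \<in> tangents G v \<and> slope G f \<eta> > 0. slope G f \<eta>)"
  have v: "v \<in> points G"
    using assms(5,6) by (auto simp: adapted_subdivision_def)
  have fin: "finite (tangents G v)"
    using assms(1) v by (rule finite_tangents)
  have S_nonneg: "0 \<le> S"
    unfolding S_def by (rule sum_nonneg) auto
  note lt = ltangents_enhanced_level_graph[OF assms(6), of G f]
  \<comment> \<open>For integers, \<open>- s - 1 < 0\<close> means \<open>0 \<le> s\<close>; legs
    drop out since their enhancement is 1.\<close>
  have "{\<eta> \<in> ltangents ?L v. enhancement ?L \<eta> < 0} =
      EdgeDir ` {\<eta> \<in> tangents G v. 0 \<le> slope G f \<eta>}"
    by (auto simp: lt enhancement_EdgeDir enhancement_LegDir)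
  then have "(\<Sum>\<eta> | \<eta> \<in> ltangents ?L v \<and> enhancement ?L \<eta> < 0. - enhancement ?L \<eta> - 1) =
      (\<Sum>\<eta> | \<eta> \<in> tangents G v \<and> 0 \<le> slope G f \<eta>. slope G f \<eta>)"
    by (simp add: sum.reindex inj_on_def enhancement_EdgeDir)
  \<comment> \<open>Directions of slope 0 contribute nothing to the sum.\<close>
  also have "\<dots> = S"
    unfolding S_def using fin by (intro sum.mono_neutral_right) auto
  finally have bound:
    "(\<Sum>\<eta> | \<eta> \<in> ltangents ?L v \<and> enhancement ?L \<eta> < 0. - enhancement ?L \<eta> - 1) = S" .
  \<comment> \<open>Legs at \<open>v\<close> force \<open>1 < S\<close>: with weight 0 the divisor
    at \<open>v\<close> is \<open>- 2\<close> plus the sum of all \<open>s + 1\<close>, which is at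
    most 0 if \<open>S \<le> 1\<close>.\<close>
  have S_gt_1: "1 < S"
    if "point_weight G v = 0" "\<forall>\<zeta>\<in>tangents G v. slope G f \<zeta> \<noteq> 0" "0 < K_plus_div G f v"
  proof (rule ccontr)
    assume "\<not> 1 < S"
    then have "(\<Sum>\<zeta>\<in>tangents G v. slope G f \<zeta> + 1) \<le> 2"
      using sum_plus_one_le_two[OF fin that(2)] by (simp add: S_def)
    with that(1,3) show False
      by (simp add: K_plus_div_eq[OF v] val_def sum.distrib)
  qed
  have "inconvenient ?L v \<longleftrightarrow> point_weight G v = 0 \<and>
      (\<forall>\<zeta>\<in>tangents G v. slope G f \<zeta> \<noteq> 0) \<and>
      ((\<exists>\<zeta>\<in>tangents G v. - slope G f \<zeta> > S) \<or> (0 < K_plus_div G f v \<and> S < 2))"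
  proof -
    have fin_lt: "finite (ltangents ?L v)"
      using fin by (simp add: lt)
    have "v \<in> lverts ?L" "base ?L = G"
      using assms(6) by (simp_all add: enhanced_level_graph_def)
    moreover have "(\<forall>\<zeta>\<in>ltangents ?L v. enhancement ?L \<zeta> \<noteq> -1) \<longleftrightarrow>
        (\<forall>\<zeta>\<in>tangents G v. slope G f \<zeta> \<noteq> 0)"
      by (simp add: lt ball_Un enhancement_EdgeDir enhancement_LegDir)
    \<comment> \<open>For an edge, \<open>- s - 1 > S - 1\<close> is \<open>- s > S\<close>; for a
      leg, \<open>1 > S - 1\<close> is \<open>S < 2\<close>. If there are legs at all, the one with
      index 0 is a witness.\<close>
    moreover have "(\<exists>\<zeta>\<in>ltangents ?L v. enhancement ?L \<zeta> > S - 1) \<longleftrightarrow>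
        (\<exists>\<zeta>\<in>tangents G v. - slope G f \<zeta> > S) \<or> (0 < K_plus_div G f v \<and> S < 2)"
      by (auto simp: lt enhancement_EdgeDir enhancement_LegDir bex_Un lessThan_empty_iff
          simp flip: ex_in_conv intro: exI[of _ 0])
    ultimately show ?thesis
      unfolding inconvenient_iff[OF fin_lt] bound by simp
  qed
  \<comment> \<open>\<open>S_gt_1\<close> rules out the leg alternative, and
    \<open>0 \<le> S\<close> turns \<open>- s > S\<close> into the additional
    \<open>s < 0\<close>.\<close>
  also have "\<dots> \<longleftrightarrow> point_weight G v = 0 \<and> (\<forall>\<zeta>\<in>tangents G v. slope G f \<zeta> \<noteq> 0) \<and>
      (\<exists>\<zeta>\<in>tangents G v. slope G f \<zeta> < 0 \<and> - slope G f \<zeta> > S)"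
    using S_gt_1 S_nonneg by force
  finally show ?thesis
    unfolding S_def .
qed

end
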